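(* Let $\lambda \ge 1.05$ and let $\mathbb{\Lambda}=\{\pm\lambda^n : n\in\mathbb{Z}\}$. The lattice $\mathbb{\Lambda}$ is nondegenerate exactly in the following three cases, and in each case the complete list of triads at unity, i.e. of pairs $(p,q)\in\mathbb{\Lambda}\times\mathbb{\Lambda}$ with $p+q=1$, is as stated: (i) $\lambda=2$; the triads at unity are $(p,q)=(2,-1),\,(-1,2),\,(1/2,1/2)$. (ii) $\lambda=\sigma$, the plastic number; the triads at unity are $(p,q)=(\sigma^3,-\sigma),\,(-\sigma,\sigma^3),\,(\sigma^2,-\sigma^{-1}),\,(-\sigma^{-1},\sigma^2),\,(\sigma^{-3},\sigma^{-2}),\,(\sigma^{-2},\sigma^{-3}),\,(\sigma^5,-\sigma^4),\,(-\sigma^4,\sigma^5),\,(\sigma,-\sigma^{-4}),\,(-\sigma^{-4},\sigma),\,(\sigma^{-5},\sigma^{-1}),\,(\sigma^{-1},\sigma^{-5})$. (iii) $\lambda$ satisfies $1=\lambda^b-\lambda^a$, where $0\le a<b$ are mutually prime integers not larger than $62$, with $(a,b)\neq(1,3)$ and $(a,b)\neq(4,5)$; the triads at unity are $(p,q)=(\lambda^b,-\lambda^a),\,(-\lambda^a,\lambda^b),\,(\lambda^{b-a},-\lambda^{-a}),\,(-\lambda^{-a},\lambda^{b-a}),\,(\lambda^{-b},\lambda^{a-b}),\,(\lambda^{a-b},\lambda^{-b})$.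
   Context: For a real $\lambda>1$, the logarithmic lattice with spacing factor $\lambda$ is $\mathbb{\Lambda}=\{\pm\lambda^n\}_{n\in\mathbb{Z}}\subset\mathbb{R}$. Three points $k,p,q\in\mathbb{\Lambda}$ form a triad if $k=p+q$; then $k$ is said to interact with $p$ and $q$. Call two nodes adjacent if they belong to a common triad; the lattice is nondegenerate if every two nodes are connected through a finite sequence of triads (i.e. the adjacency graph is connected). The plastic number $\sigma=\frac{\sqrt[3]{9+\sqrt{69}}+\sqrt[3]{9-\sqrt{69}}}{\sqrt[3]{18}}\approx 1.325$ is the unique real root of $x^3-x-1=0$ (it also satisfies $\sigma^5-\sigma^4-1=0$). *)

theory Defs
  imports Complex_Main
begin

definition loglattice :: "real \<Rightarrow> real set" where
  "loglattice l = {x. \<exists>n::int. x = l powi n \<or> x = - (l powi n)}"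

definition triad :: "real \<Rightarrow> real \<Rightarrow> real \<Rightarrow> real \<Rightarrow> bool" where
  "triad l k p q \<longleftrightarrow> k \<in> loglattice l \<and> p \<in> loglattice l \<and> q \<in> loglattice l \<and> k = p + q"

definition adjacent :: "real \<Rightarrow> real \<Rightarrow> real \<Rightarrow> bool" where
  "adjacent l x y \<longleftrightarrow> (\<exists>k p q. triad l k p q \<and> x \<in> {k, p, q} \<and> y \<in> {k, p, q})"

definition nondegenerate :: "real \<Rightarrow> bool" where
  "nondegenerate l \<longleftrightarrow> (\<forall>x \<in> loglattice l. \<forall>y \<in> loglattice l. (adjacent l)\<^sup>*\<^sup>* x y)"

definition triads_at_unity :: "real \<Rightarrow> (real \<times> real) set" where
  "triads_at_unity l = {(p, q). p \<in> loglattice l \<and> q \<in> loglattice l \<and> p + q = 1}"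

definition plastic :: real where
  "plastic = (root 3 (9 + sqrt 69) + root 3 (9 - sqrt 69)) / root 3 18"

end

theory Submission
  imports Defs "HOL-Computational_Algebra.Polynomial_Factorial"
begin

text \<open>
  Multiplying by a power of \<open>\<lambda>\<close> turns every triad at unity into a relation
  \<open>\<lambda>\<^sup>b - \<lambda>\<^sup>a = 1\<close> with \<open>0 \<le> a < b\<close>, so everything depends on how many such relations a
  given \<open>\<lambda>\<close> satisfies. Suppose \<open>\<lambda>\<close> is a root of both \<open>T = x\<^sup>b - x\<^sup>a - 1\<close> and
  \<open>T' = x\<^sup>d - x\<^sup>c - 1\<close> with \<open>a, c > 0\<close>, and write \<open>T = f g\<close>, \<open>T' = f g'\<close> where the integer
  polynomial \<open>f\<close> vanishes at \<open>\<lambda>\<close>. Let \<open>*\<close> denote the reciprocal polynomial. Following Ljunggren, \<open>h = f g*\<close>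
  satisfies \<open>h h* = T T*\<close>, hence the squares of its coefficients sum to 3, which forces
  \<open>h = \<plusminus>T\<close> or \<open>h = \<plusminus>T*\<close>. In the first case \<open>g* = \<plusminus>g\<close>; the second would make \<open>1/\<lambda>\<close> a root of
  \<open>T\<close>, which is impossible for \<open>\<lambda> > 1\<close>. So both cofactors are reciprocal up to sign and
  \<open>T T'* = T* T'\<close>. Comparing exponents leaves, apart from \<open>(a, b) = (c, d)\<close>, only the pairs
  \<open>(t, 3t)\<close> and \<open>(4t, 5t)\<close>, i.e. \<open>\<lambda>\<^sup>t\<close> is the plastic number. Consequently all relations have the
  same \<open>gcd(a, b)\<close>, and the lattice is nondegenerate iff this gcd is 1.
\<close>

subsection \<open>Integer polynomials with a common real root\<close>

abbreviation ipoly :: "int poly \<Rightarrow> real \<Rightarrow> real" where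
  "ipoly p x \<equiv> poly (map_poly of_int p) x"

lemma ipoly_mult: "ipoly (p * q) x = ipoly p x * ipoly q x"
proof -
  have "map_poly of_int (p * q) = (map_poly of_int p * map_poly of_int q :: real poly)"
    by (intro poly_eqI) (simp add: coeff_map_poly coeff_mult)
  then show ?thesis by simp
qed

lemma ipoly_add: "ipoly (p + q) x = ipoly p x + ipoly q x"
proof -
  have "map_poly of_int (p + q) = (map_poly of_int p + map_poly of_int q :: real poly)"
    by (intro poly_eqI) (simp add: coeff_map_poly)
  then show ?thesis by simp
qed

lemma ipoly_diff: "ipoly (p - q) x = ipoly p x - ipoly q x"
proof -
  have "map_poly of_int (p - q) = (map_poly of_int p - map_poly of_int q :: real poly)"
    by (intro poly_eqI) (simp add: coeff_map_poly)
  then show ?thesis by simp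
qed

lemma ipoly_smult: "ipoly (smult c p) x = of_int c * ipoly p x"
proof -
  have "map_poly of_int (smult c p) = (smult (of_int c) (map_poly of_int p) :: real poly)"
    by (intro poly_eqI) (simp add: coeff_map_poly)
  then show ?thesis by simp
qed

lemma ipoly_monom: "ipoly (monom c n) x = of_int c * x ^ n"
  by (simp add: map_poly_monom poly_monom)

lemma ipoly_eq_0_imp_degree_pos:
  assumes "f \<noteq> 0" "ipoly f x = 0"
  shows "degree f > 0"
proof (rule ccontr)
  assume "\<not> degree f > 0"
  then obtain c where "f = [:c:]" using degree_eq_zeroE by blast
  then show False using assms by (simp add: map_poly_pCons)
qed

text \<open>The divisor is the primitive part of an integer polynomial of least degree vanishing at
  \<open>x\<close>. Primitivity is what yields divisibility over the integers rather than only over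
  the rationals.\<close>

lemma common_root_imp_common_divisor:
  fixes S T :: "int poly"
  assumes "S \<noteq> 0" "ipoly S x = 0" "ipoly T x = 0"
  obtains f where "f dvd S" "f dvd T" "ipoly f x = 0"
proof -
  define P where "P f \<longleftrightarrow> f \<noteq> 0 \<and> ipoly f x = 0" for f
  have "P S" using assms by (simp add: P_def)
  then obtain f0 where f0: "P f0" "\<And>h. P h \<Longrightarrow> degree f0 \<le> degree h"
    by (metis (no_types, lifting) arg_min_nat_lemma)
  define f where "f = primitive_part f0"
  have f0_eq: "f0 = smult (content f0) f"
    by (simp add: f_def)
  have "f \<noteq> 0" using f0 by (auto simp: f_def P_def)
  have "ipoly f0 x = 0" using f0 by (simp add: P_def)
  then have "of_int (content f0) * ipoly f x = 0" using f0_eq ipoly_smult by metis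
  then have fx: "ipoly f x = 0" using f0 by (auto simp: P_def)
  have deg: "degree f = degree f0" by (simp add: f_def)
  have cf: "content f = 1" using f0 by (simp add: f_def P_def)
  have dvd: "f dvd Q" if Q: "ipoly Q x = 0" for Q
  proof -
    \<comment> \<open>Over the integers, division with remainder is available only after scaling
      \<open>Q\<close> by some \<open>c\<close>. The remainder vanishes at \<open>x\<close>, so
      minimality of the degree kills it.\<close>
    obtain c q r where "c \<noteq> 0" and 1: "smult c Q = f * q + r" and r: "r = 0 \<or> degree r < degree f"
      using pseudo_mod[OF \<open>f \<noteq> 0\<close>] by metis
    have "ipoly r x = 0"
      using arg_cong[OF 1, of "\<lambda>p. ipoly p x"] Q fx by (simp add: ipoly_smult ipoly_add ipoly_mult)
    then have "r = 0" using r f0(2)[of r] deg unfolding P_def by linarith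
    then have 2: "smult c Q = f * q" using 1 by simp
    \<comment> \<open>Gauss's lemma: \<open>f\<close> has content 1, so the factor \<open>c\<close>
      sits entirely in \<open>q\<close> and can be cancelled.\<close>
    have "content q = content (smult c Q)" using 2 cf by (simp add: content_mult)
    then have "c dvd content q" by simp
    then have "[:c:] dvd q" by (simp add: const_poly_dvd_iff_dvd_content)
    then obtain q' where "q = smult c q'" by (auto elim: dvdE)
    then have "smult c (Q - f * q') = 0" using 2 by (simp add: smult_diff_right)
    then show ?thesis using \<open>c \<noteq> 0\<close> by simp
  qed
  show ?thesis using that[of f] dvd assms fx by blast
qed

subsection \<open>Factors of trinomials\<close>

definition trinomial :: "nat \<Rightarrow> nat \<Rightarrow> int poly" where
  "trinomial a b = monom 1 b - monom 1 a - 1"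

lemma coeff_trinomial:
  "coeff (trinomial a b) i = of_bool (i = b) - of_bool (i = a) - of_bool (i = 0)"
  by (auto simp: trinomial_def coeff_monom)

lemma degree_trinomial: "a < b \<Longrightarrow> degree (trinomial a b) = b"
  by (rule antisym) (auto intro!: degree_le le_degree simp: coeff_trinomial)

lemma reflect_trinomial:
  assumes "0 < a" "a < b"
  shows "reflect_poly (trinomial a b) = 1 - monom 1 (b - a) - monom 1 b"
  using assms by (intro poly_eqI) (auto simp: coeff_reflect_poly degree_trinomial coeff_trinomial coeff_monom)

lemma ipoly_trinomial: "ipoly (trinomial a b) x = x ^ b - x ^ a - 1"
proof -
  have "ipoly 1 x = 1" by simp
  then show ?thesis by (simp add: trinomial_def ipoly_diff ipoly_monom)
qed

section \<open>Ljunggren's method: trinomials and their products with the reciprocal\<close>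

lemma coeff_mult_reflect:
  fixes h :: "int poly"
  shows "coeff (h * reflect_poly h) (degree h) = (\<Sum>i\<le>degree h. (coeff h i)\<^sup>2)"
  by (auto simp: coeff_mult coeff_reflect_poly power2_eq_square intro!: sum.cong)

lemma trinomial_mult_reflect:
  assumes "0 < a" "a < b"
  shows "trinomial a b * reflect_poly (trinomial a b) =
    monom 3 b - monom 1 (2*b) - 1 - monom 1 (2*b - a) + monom 1 (a + b) + monom 1 (b - a) - monom 1 a"
proof -
  define c where "c = b - a"
  have b: "b = a + c" using assms by (simp add: c_def)
  \<comment> \<open>Splitting the coefficient 3 leaves only unit monomials, which cancel
    syntactically.\<close>
  have 3: "monom 3 n = monom (1::int) n + monom 1 n + monom 1 n" for n by (simp add: add_monom)
  show ?thesis
    unfolding reflect_trinomial[OF assms] unfolding trinomial_def 3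
    by (simp add: b algebra_simps mult_monom) (simp add: mult_2 mult_2_right ac_simps)
qed

text \<open>Strictly between degrees 0 and \<open>b\<close> the product is
  \<open>x^(b-a) - x^a\<close>, whose signs tell \<open>a\<close> from \<open>b - a\<close>. If
  these terms cancel, then \<open>b = 2a\<close>, and the same cancellation for \<open>k\<close>
  forces \<open>b = 2k\<close>.\<close>

lemma trinomial_mult_reflect_inject:
  assumes "0 < a" "a < b" "0 < k" "k < b"
    and eq: "trinomial k b * reflect_poly (trinomial k b) = trinomial a b * reflect_poly (trinomial a b)"
  shows "k = a"
proof -
  have c: "coeff (trinomial i b * reflect_poly (trinomial i b)) j = of_bool (j = b - i) - of_bool (j = i)"
    if "0 < i" "i < b" "0 < j" "j < b" for i j
    using that by (auto simp: trinomial_mult_reflect coeff_monom)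
  have *: "(of_bool (j = b - k) - of_bool (j = k) :: int) = of_bool (j = b - a) - of_bool (j = a)"
    if "0 < j" "j < b" for j
    using c[of k j] c[of a j] that assms by simp
  show ?thesis using *[of a] *[of k] assms by (auto simp: of_bool_def split: if_splits)
qed

text \<open>The outer coefficients of \<open>h\<close> have product -1, so they are 1 and -1 in some
  order. The middle coefficient of the product, 3, is the sum of the squares of the coefficients of
  \<open>h\<close>, which leaves exactly one inner term, with coefficient 1 or -1. If its sign
  agrees with the constant term, \<open>h\<close> is a trinomial up to sign; if it agrees with the
  leading term, \<open>h\<close> is a reciprocal one.\<close>

lemma same_autocorrelation_as_trinomial:
  assumes ab: "0 < a" "a < b" and deg: "degree h = b"
    and eq: "h * reflect_poly h = trinomial a b * reflect_poly (trinomial a b)"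
  obtains e :: int where "e \<in> {1, -1}"
    "h = smult e (trinomial a b) \<or> h = smult e (reflect_poly (trinomial a b))"
proof -
  have "coeff (h * reflect_poly h) 0 = -1"
    using ab by (simp add: eq coeff_mult coeff_trinomial degree_trinomial)
  then have prod: "coeff h 0 * coeff h b = -1"
    using deg by (simp add: coeff_mult)
  define e where "e = coeff h 0"
  have "e dvd 1" using prod unfolding e_def by (metis dvd_minus_iff dvd_triv_left)
  then have e: "e = 1 \<or> e = -1" by auto
  then have hb: "coeff h b = - e" using prod unfolding e_def[symmetric] by auto
  have "coeff (h * reflect_poly h) b = 3"
    using ab by (auto simp: eq trinomial_mult_reflect coeff_monom)
  then have "(\<Sum>i\<le>b. (coeff h i)\<^sup>2) = 3"
    using coeff_mult_reflect[of h] deg by simp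
  moreover have "{..b} = insert 0 (insert b {0<..<b})" using ab by auto
  ultimately have sum: "(\<Sum>i\<in>{0<..<b}. (coeff h i)\<^sup>2) = 1"
    using ab e hb e_def by auto
  then obtain k where k: "k \<in> {0<..<b}" "coeff h k \<noteq> 0"
    by (metis (no_types, lifting) sum.neutral zero_neq_one zero_power2)
  have "(\<Sum>i\<in>{0<..<b}. (coeff h i)\<^sup>2) = (coeff h k)\<^sup>2 + (\<Sum>i\<in>{0<..<b} - {k}. (coeff h i)\<^sup>2)"
    using k by (simp add: sum.remove)
  moreover have "(\<Sum>i\<in>{0<..<b} - {k}. (coeff h i)\<^sup>2) \<ge> 0" by (simp add: sum_nonneg)
  moreover have "(coeff h k)\<^sup>2 > 0" using k by simp
  ultimately have sqk: "(coeff h k)\<^sup>2 = 1" and rest: "(\<Sum>i\<in>{0<..<b} - {k}. (coeff h i)\<^sup>2) = 0"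
    using sum by linarith+
  have zero: "coeff h i = 0" if "0 < i" "i < b" "i \<noteq> k" for i
    using rest that by (subst (asm) sum_nonneg_eq_0_iff) auto
  have hk: "coeff h k = e \<or> coeff h k = - e" using sqk e by (auto simp: power2_eq_1_iff)
  have zero': "coeff h i = 0" if "b < i" for i using that deg by (simp add: coeff_eq_0)
  have hi: "coeff h i = (if i = 0 then e else if i = b then - e else if i = k then coeff h k else 0)" for i
    using zero[of i] zero'[of i] hb e_def by (cases i b rule: linorder_cases) auto
  have ee: "e * e = 1" using e by auto
  from hk show ?thesis
  proof
    assume *: "coeff h k = e"
    have h: "h = smult (- e) (trinomial k b)"
      using k ab by (intro poly_eqI, subst hi) (auto simp: * coeff_trinomial)
    have "h * reflect_poly h = trinomial k b * reflect_poly (trinomial k b)"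
      unfolding h reflect_poly_smult by (simp add: ee flip: smult_minus_left)
    then have "k = a" using trinomial_mult_reflect_inject ab k eq by simp
    then show ?thesis using that[of "- e"] h e by auto
  next
    assume *: "coeff h k = - e"
    have T: "reflect_poly (reflect_poly (trinomial (b - k) b)) = trinomial (b - k) b"
      using k by (simp add: coeff_trinomial)
    have h: "h = smult e (reflect_poly (trinomial (b - k) b))"
      using k ab by (intro poly_eqI, subst hi) (auto simp: * reflect_trinomial coeff_monom)
    have "h * reflect_poly h = trinomial (b - k) b * reflect_poly (trinomial (b - k) b)"
      unfolding h reflect_poly_smult T by (simp add: ee mult.commute)
    then have "b - k = a" using trinomial_mult_reflect_inject[of a b "b - k"] ab k eq by simp
    then show ?thesis using that[of e] h e by auto
  qed
qed

lemma cofactor_reciprocal: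
  fixes x :: real
  assumes ab: "0 < a" "a < b" and fg: "trinomial a b = f * g" and x: "x > 1" "ipoly f x = 0"
  obtains e :: int where "e \<in> {1, -1}" "reflect_poly g = smult e g"
proof -
  have T0: "coeff (trinomial a b) 0 = -1" using ab by (simp add: coeff_trinomial)
  then have f0: "coeff f 0 \<noteq> 0" and g0: "coeff g 0 \<noteq> 0" using fg by (auto simp: coeff_mult)
  then have nz: "f \<noteq> 0" "g \<noteq> 0" by auto
  define h where "h = f * reflect_poly g"
  have rh: "reflect_poly h = reflect_poly f * g" by (simp add: h_def reflect_poly_mult reflect_poly_reflect_poly[OF g0])
  \<comment> \<open>Reflection preserves the degree of \<open>g\<close> because its constant term is
    nonzero.\<close>
  have "degree h = degree (f * g)" using nz g0 by (simp add: h_def degree_mult_eq)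
  then have deg: "degree h = b" using ab by (simp add: fg[symmetric] degree_trinomial)
  have eq: "h * reflect_poly h = trinomial a b * reflect_poly (trinomial a b)"
    unfolding rh unfolding h_def fg reflect_poly_mult by (simp add: ac_simps)
  obtain e :: int where e: "e \<in> {1, -1}"
    "h = smult e (trinomial a b) \<or> h = smult e (reflect_poly (trinomial a b))"
    using same_autocorrelation_as_trinomial[OF ab deg eq] .
  from e(2) show ?thesis
  proof
    assume "h = smult e (trinomial a b)"
    then have "f * reflect_poly g = f * smult e g" by (simp add: h_def fg)
    then have "reflect_poly g = smult e g" using nz mult_left_cancel by blast
    then show ?thesis using that e(1) by blast
  next
    assume "h = smult e (reflect_poly (trinomial a b))"
    then have "ipoly h x = e * ipoly (reflect_poly (trinomial a b)) x" by (simp add: ipoly_smult)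
    moreover have "ipoly h x = 0" using x by (simp add: h_def ipoly_mult)
    \<comment> \<open>\<open>h\<close> inherits the root \<open>x\<close> from \<open>f\<close>, but
      the reciprocal trinomial is negative everywhere beyond 1.\<close>
    ultimately have "ipoly (reflect_poly (trinomial a b)) x = 0" using e by auto
    moreover have "ipoly 1 x = 1" by simp
    ultimately have "1 - x ^ (b - a) - x ^ b = 0"
      using ab by (simp add: reflect_trinomial ipoly_diff ipoly_monom)
    moreover have "x ^ (b - a) > 0" "x ^ b > 1" using x ab by simp_all
    ultimately show ?thesis by linarith
  qed
qed

text \<open>With \<open>f\<close> the common divisor and \<open>g\<close>, \<open>g'\<close> the
  cofactors, both sides equal \<open>f * reflect_poly f * g * g'\<close> up to sign, since
  \<open>g\<close> and \<open>g'\<close> are reciprocal up to sign. The constant terms, both -1,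
  settle the sign.\<close>

lemma trinomial_cross:
  fixes x :: real
  assumes ab: "0 < a" "a < b" and cd: "0 < c" "c < d"
    and x: "x > 1" "x ^ b - x ^ a = 1" "x ^ d - x ^ c = 1"
  shows "trinomial a b * reflect_poly (trinomial c d) = reflect_poly (trinomial a b) * trinomial c d"
proof -
  have nz: "trinomial a b \<noteq> 0" "trinomial c d \<noteq> 0"
    using degree_trinomial ab cd by fastforce+
  obtain f where f: "f dvd trinomial a b" "f dvd trinomial c d" "ipoly f x = 0"
    using common_root_imp_common_divisor[OF nz(1), of x "trinomial c d"] x
    by (auto simp: ipoly_trinomial)
  obtain g where g: "trinomial a b = f * g" using f by (auto elim: dvdE)
  obtain g' where g': "trinomial c d = f * g'" using f by (auto elim: dvdE)
  obtain e where e: "e \<in> {1, -1}" "reflect_poly g = smult e g"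
    using cofactor_reciprocal[OF ab g x(1) f(3)] .
  obtain e' where e': "e' \<in> {1, -1}" "reflect_poly g' = smult e' g'"
    using cofactor_reciprocal[OF cd g' x(1) f(3)] .
  define s where "s = e * e'"
  have s: "trinomial a b * reflect_poly (trinomial c d) = smult s (reflect_poly (trinomial a b) * trinomial c d)"
    using e(1) e'(1) by (auto simp: g g' e(2) e'(2) reflect_poly_mult s_def)
  have "coeff (trinomial a b * reflect_poly (trinomial c d)) 0 = -1"
    "coeff (reflect_poly (trinomial a b) * trinomial c d) 0 = -1"
    using ab cd by (simp_all add: coeff_mult coeff_trinomial degree_trinomial)
  then have "s = 1" using arg_cong[OF s, of "\<lambda>p. coeff p 0"] by simp
  then show ?thesis using s by simp
qed

section \<open>Comparison of exponents in the cross identity\<close>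

lemma sum_monom_mset_inject:
  assumes "(\<Sum>n\<in>#M. monom (1::int) n) = (\<Sum>n\<in>#N. monom 1 n)"
  shows "M = N"
proof (rule multiset_eqI)
  fix j
  have "coeff (\<Sum>n\<in>#M. monom (1::int) n) j = int (count M j)" for M
    by (induction M) (auto simp: coeff_monom)
  then show "count M j = count N j" using assms by (metis of_nat_eq_iff)
qed

text \<open>Of the nine terms on each side of the expanded identity, four are common. Moving the
  negative ones across leaves five unit monomials on each side. The gaps \<open>m\<close> and
  \<open>n\<close> replace \<open>b\<close> and \<open>d\<close> to avoid truncated
  subtraction.\<close>

lemma trinomial_cross_exponents:
  assumes "0 < a" "0 < c" "0 < m" "0 < n"
    and "trinomial a (a + m) * reflect_poly (trinomial c (c + n)) =
      reflect_poly (trinomial a (a + m)) * trinomial c (c + n)"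
  shows "{#c, c + n + m, a + n, a + c + n, n#} = {#a, a + m + n, c + m, c + a + m, m#}"
proof (rule sum_monom_mset_inject)
  have "(monom 1 (a + m) - monom 1 a - 1) * (1 - monom 1 n - monom 1 (c + n)) =
    (1 - monom 1 m - monom 1 (a + m)) * (monom (1::int) (c + n) - monom 1 c - 1)"
    using assms by (simp add: reflect_trinomial) (simp add: trinomial_def)
  then show "(\<Sum>i\<in>#{#c, c + n + m, a + n, a + c + n, n#}. monom (1::int) i) =
    (\<Sum>i\<in>#{#a, a + m + n, c + m, c + a + m, m#}. monom 1 i)"
    by (simp add: algebra_simps mult_monom)
qed

text \<open>The argument combines the totals of the two multisets with the possible places of
  \<open>a\<close> on the left and of \<open>c\<close> on the right. If \<open>a < c\<close>, then
  \<open>a = n\<close>; the totals exclude \<open>c = m\<close>, so \<open>c = a + m + n\<close>,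
  and the totals then give \<open>m = 2n\<close>. The case \<open>a > c\<close> is
  symmetric.\<close>

lemma exponents_eq:
  fixes a c m n :: nat
  assumes pos: "0 < a" "0 < c" "0 < m" "0 < n"
    and eq: "{#c, c + n + m, a + n, a + c + n, n#} = {#a, a + m + n, c + m, c + a + m, m#}"
  shows "(a = c \<and> m = n) \<or> (a = 4 * m \<and> c = m \<and> n = 2 * m) \<or> (c = 4 * n \<and> a = n \<and> m = 2 * n)"
proof -
  have sum: "c + 3 * n = a + 3 * m" using arg_cong[OF eq, of sum_mset] by simp
  have "a \<in># {#c, c + n + m, a + n, a + c + n, n#}" by (subst eq) simp
  moreover have "c \<in># {#a, a + m + n, c + m, c + a + m, m#}" by (subst eq[symmetric]) simp
  ultimately have a: "a = c \<or> a = c + n + m \<or> a = n" and c: "c = a \<or> c = a + m + n \<or> c = m"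
    using pos by simp_all
  show ?thesis
  proof (cases a c rule: linorder_cases)
    case less
    then have "n = a" using a by auto
    moreover from this have "c = a + m + n" using c less sum by auto
    ultimately show ?thesis using sum by simp
  next
    case equal
    then show ?thesis using sum by simp
  next
    case greater
    then have "m = c" using c by auto
    moreover from this have "a = c + n + m" using a greater sum by auto
    ultimately show ?thesis using sum by simp
  qed
qed

text \<open>The common divisor has odd constant term, so, \<open>x\<^sup>b - 2\<close> being a pure power modulo 2,
  its cofactor would have to carry the whole degree.\<close>
lemma no_trinomial_root_of_two:
  fixes x :: real
  assumes c: "0 < c" and x: "x > 1" "x ^ b = 2" "x ^ d - x ^ c = 1"
  shows False
proof -
  have b: "b > 0" using x by (cases b) auto
  have "x ^ c < x ^ d" using x by linarith
  then have cd: "c < d" using x(1) power_less_imp_less_exp by blast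
  define S :: "int poly" where "S = monom 1 b - [:2:]"
  have cS: "coeff S i = of_bool (i = b) - 2 * of_bool (i = 0)" for i
    by (auto simp: S_def coeff_monom coeff_pCons split: nat.splits)
  have degS: "degree S = b"
    using b by (intro antisym) (auto intro!: degree_le le_degree simp: cS)
  have "S \<noteq> 0" using degS b by auto
  moreover have "ipoly S x = 0"
    using x by (simp add: S_def ipoly_diff ipoly_monom map_poly_pCons)
  moreover have "ipoly (trinomial c d) x = 0" using x by (simp add: ipoly_trinomial)
  ultimately obtain f where f: "f dvd S" "f dvd trinomial c d" "ipoly f x = 0"
    using common_root_imp_common_divisor by blast
  obtain g where g: "S = f * g" using f by (auto elim: dvdE)
  obtain g' where g': "trinomial c d = f * g'" using f by (auto elim: dvdE)
  have "coeff f 0 * coeff g' 0 = coeff (trinomial c d) 0" by (simp add: g' coeff_mult)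
  also have "\<dots> = -1" using c cd by (simp add: coeff_trinomial)
  finally have "odd (coeff f 0 * coeff g' 0)" by simp
  then have f0: "odd (coeff f 0)" by simp
  have nz: "f \<noteq> 0" "g \<noteq> 0" using \<open>S \<noteq> 0\<close> g by auto
  have "lead_coeff f * lead_coeff g = coeff S b" using degS g by (metis lead_coeff_mult)
  also have "\<dots> = 1" using b by (simp add: cS)
  finally have "odd (lead_coeff f * lead_coeff g)" by simp
  then have ex: "odd (coeff g (degree g))" by simp
  \<comment> \<open>This is the lowest term of \<open>g\<close> modulo 2. As \<open>f\<close> has
    odd constant term, it is also the lowest term of \<open>S\<close> modulo 2, hence
    \<open>j = b\<close>.\<close>
  define j where "j = (LEAST j. odd (coeff g j))"
  have j: "odd (coeff g j)" unfolding j_def using LeastI[of "\<lambda>j. odd (coeff g j)"] ex by blast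
  have less: "even (coeff g i)" if "i < j" for i
    using not_less_Least[of i "\<lambda>j. odd (coeff g j)"] that unfolding j_def by blast
  have "coeff S j = coeff f 0 * coeff g j + (\<Sum>i\<in>{..j} - {0}. coeff f i * coeff g (j - i))"
    by (simp add: g coeff_mult sum.remove[of _ 0])
  moreover have "even (\<Sum>i\<in>{..j} - {0}. coeff f i * coeff g (j - i))"
    by (rule dvd_sum) (simp add: less)
  ultimately have "odd (coeff S j)" using f0 j by simp
  then have "j = b" by (simp add: cS split: if_splits)
  moreover have "coeff g j \<noteq> 0" using j by auto
  then have "j \<le> degree g" by (rule le_degree)
  moreover have "degree f + degree g = b" using degS g nz by (simp add: degree_mult_eq)
  ultimately have "degree f = 0" by simp
  then show False using ipoly_eq_0_imp_degree_pos[OF nz(1) f(3)] by simp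
qed

subsection \<open>Solutions of the exponential equation\<close>

text \<open>Natural exponents suffice: dividing a triad by its entry of least absolute value and
  rearranging signs gives \<open>x^b = x^a + 1\<close>.\<close>

definition unity_exponents :: "real \<Rightarrow> (nat \<times> nat) set" where
  "unity_exponents x = {(a, b). x ^ b - x ^ a = 1}"

lemma unity_exponents_less:
  assumes "x > 1" "(a, b) \<in> unity_exponents x"
  shows "a < b"
proof -
  have "x ^ b - x ^ a = 1" using assms(2) by (simp add: unity_exponents_def)
  then have "x ^ a < x ^ b" by linarith
  then show ?thesis using assms(1) power_less_imp_less_exp by blast
qed

text \<open>The trinomial argument requires positive inner exponents. An exponent 0 means that a
  power of \<open>x\<close> equals 2, so it is treated separately by
  \<open>no_trinomial_root_of_two\<close>.\<close>

lemma unity_exponents_unique: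
  fixes x :: real
  assumes x: "x > 1" and ab: "(a, b) \<in> unity_exponents x" and cd: "(c, d) \<in> unity_exponents x"
  shows "(a, b) = (c, d) \<or> (\<exists>t. (a, b) = (t, 3 * t) \<and> (c, d) = (4 * t, 5 * t)) \<or>
    (\<exists>t. (a, b) = (4 * t, 5 * t) \<and> (c, d) = (t, 3 * t))"
proof -
  have lt: "a < b" "c < d" using unity_exponents_less assms by blast+
  have eqs: "x ^ b - x ^ a = 1" "x ^ d - x ^ c = 1" using ab cd by (auto simp: unity_exponents_def)
  consider "a = 0" "c = 0" | "a = 0" "c > 0" | "a > 0" "c = 0" | "a > 0" "c > 0" by blast
  then show ?thesis
  proof cases
    case 1
    then have "x ^ b = x ^ d" using eqs by simp
    then show ?thesis using 1 x by (simp add: power_inject_exp)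
  next
    case 2
    then show ?thesis using no_trinomial_root_of_two[of c x b d] x eqs by simp
  next
    case 3
    then show ?thesis using no_trinomial_root_of_two[of a x d b] x eqs by simp
  next
    case 4
    define m where "m = b - a"
    define n where "n = d - c"
    have b: "b = a + m" and d: "d = c + n" and mn: "0 < m" "0 < n"
      using lt by (auto simp: m_def n_def)
    have "trinomial a b * reflect_poly (trinomial c d) = reflect_poly (trinomial a b) * trinomial c d"
      using trinomial_cross[OF 4(1) lt(1) 4(2) lt(2) x eqs] .
    then have "(a = c \<and> m = n) \<or> (a = 4 * m \<and> c = m \<and> n = 2 * m) \<or> (c = 4 * n \<and> a = n \<and> m = 2 * n)"
      unfolding b d using exponents_eq[OF 4 mn] trinomial_cross_exponents[OF 4 mn] by blast
    then show ?thesis using b d by auto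
  qed
qed

text \<open>Both exceptional families have gcd \<open>t\<close>; coprimality forces
  \<open>t = 1\<close>, and the two pairs with \<open>t = 1\<close> are excluded.\<close>

lemma unity_exponents_coprime_unique:
  assumes "x > 1" "(a, b) \<in> unity_exponents x" "coprime a b"
    and "(a, b) \<noteq> (1, 3)" "(a, b) \<noteq> (4, 5)"
  shows "unity_exponents x = {(a, b)}"
proof -
  have "(a, b) \<noteq> (t, 3 * t) \<and> (a, b) \<noteq> (4 * t, 5 * t)" for t
    using assms(3-5) by (cases "t = 1") auto
  then have "p = (a, b)" if "p \<in> unity_exponents x" for p
    using unity_exponents_unique[OF assms(1,2), of "fst p" "snd p"] that by (metis prod.collapse)
  then show ?thesis using assms(2) by blast
qed

lemma unity_exponents_common_gcd:
  assumes "x > 1" "(a, b) \<in> unity_exponents x" "(c, d) \<in> unity_exponents x"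
  shows "gcd a b = gcd c d"
proof -
  have "gcd t (3 * t) = t" "gcd (4 * t) (5 * t) = t" for t :: nat
    using gcd_mult_distrib_nat[of t 4 5] by (simp_all add: gcd_non_0_nat mult.commute)
  then show ?thesis using unity_exponents_unique[OF assms] by auto
qed

subsection \<open>Triads at unity\<close>

lemma loglattice_iff:
  "x \<in> loglattice l \<longleftrightarrow> (\<exists>n. x = l ^ n \<or> x = 1 / l ^ n \<or> x = - (l ^ n) \<or> x = - (1 / l ^ n))"
proof
  assume "x \<in> loglattice l"
  then obtain n :: int where n: "x = l powi n \<or> x = - (l powi n)" by (auto simp: loglattice_def)
  show "\<exists>n. x = l ^ n \<or> x = 1 / l ^ n \<or> x = - (l ^ n) \<or> x = - (1 / l ^ n)"
    using n by (cases n rule: int_cases2) (auto simp: power_int_minus field_simps)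
next
  assume "\<exists>n. x = l ^ n \<or> x = 1 / l ^ n \<or> x = - (l ^ n) \<or> x = - (1 / l ^ n)"
  then obtain n where n: "x = l ^ n \<or> x = 1 / l ^ n \<or> x = - (l ^ n) \<or> x = - (1 / l ^ n)" by blast
  have "l ^ n = l powi (int n)" "1 / l ^ n = l powi (- int n)"
    by (simp_all add: power_int_minus field_simps)
  then show "x \<in> loglattice l" using n unfolding loglattice_def mem_Collect_eq by metis
qed

lemma one_in_loglattice [simp]: "1 \<in> loglattice l"
  unfolding loglattice_iff by (rule exI[of _ 0]) simp

lemma uminus_in_loglattice: "x \<in> loglattice l \<Longrightarrow> - x \<in> loglattice l"
  unfolding loglattice_iff by auto

lemma power_in_loglattice: "l ^ n \<in> loglattice l"
  unfolding loglattice_iff by auto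

lemma inverse_power_in_loglattice: "1 / l ^ n \<in> loglattice l"
  unfolding loglattice_iff by auto

lemma mult_in_loglattice:
  assumes "l \<noteq> 0" "x \<in> loglattice l" "y \<in> loglattice l"
  shows "x * y \<in> loglattice l"
proof -
  obtain m n where "x = l powi m \<or> x = - (l powi m)" "y = l powi n \<or> y = - (l powi n)"
    using assms by (auto simp: loglattice_def)
  then have "x * y = l powi (m + n) \<or> x * y = - (l powi (m + n))"
    using assms(1) by (auto simp: power_int_add)
  then show ?thesis by (auto simp: loglattice_def)
qed

lemma divide_in_loglattice:
  assumes "l \<noteq> 0" "x \<in> loglattice l" "y \<in> loglattice l"
  shows "x / y \<in> loglattice l"
proof -
  obtain m n where "x = l powi m \<or> x = - (l powi m)" "y = l powi n \<or> y = - (l powi n)"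
    using assms by (auto simp: loglattice_def)
  then have "x / y = l powi (m - n) \<or> x / y = - (l powi (m - n))"
    using assms(1) by (auto simp: power_int_diff)
  then show ?thesis by (auto simp: loglattice_def)
qed

lemma nonzero_of_loglattice: "l \<noteq> 0 \<Longrightarrow> x \<in> loglattice l \<Longrightarrow> x \<noteq> 0"
  by (auto simp: loglattice_def)

text \<open>Dividing \<open>l^b = l^a + 1\<close> by each of its three terms in turn writes 1 as a
  sum in three ways; each is listed in both orders.\<close>

definition unity_pairs :: "real \<Rightarrow> nat \<Rightarrow> nat \<Rightarrow> (real \<times> real) set" where
  "unity_pairs l a b = {(l^b, -(l^a)), (-(l^a), l^b), (l^(b-a), -(1/l^a)), (-(1/l^a), l^(b-a)),
     (1/l^b, 1/l^(b-a)), (1/l^(b-a), 1/l^b)}"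

lemma unity_pairs_swap: "(p, q) \<in> unity_pairs l a b \<longleftrightarrow> (q, p) \<in> unity_pairs l a b"
  by (auto simp: unity_pairs_def)

lemma unity_pairs_in_loglattice:
  assumes "(p, q) \<in> unity_pairs l a b"
  shows "p \<in> loglattice l" "q \<in> loglattice l"
  using assms unfolding unity_pairs_def
  by (auto intro!: power_in_loglattice inverse_power_in_loglattice uminus_in_loglattice)

lemma unity_pairs_sum:
  assumes l: "l > 1" and ab: "(a, b) \<in> unity_exponents l" and pq: "(p, q) \<in> unity_pairs l a b"
  shows "p + q = 1"
proof -
  define c where "c = b - a"
  have b: "b = a + c" using unity_exponents_less[OF l ab] by (simp add: c_def)
  have eq: "l ^ a * l ^ c - l ^ a = 1" using ab by (simp add: unity_exponents_def b power_add)
  have "l \<noteq> 0" using l by simp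
  then have "l ^ c - 1 / l ^ a = (l ^ a * l ^ c - 1) / l ^ a"
    "1 / (l ^ a * l ^ c) + 1 / l ^ c = (1 + l ^ a) / (l ^ a * l ^ c)"
    by (simp_all add: field_simps)
  moreover have "l ^ a * l ^ c - 1 = l ^ a" "1 + l ^ a = l ^ a * l ^ c" using eq by linarith+
  ultimately have "l ^ c - 1 / l ^ a = 1" "1 / (l ^ a * l ^ c) + 1 / l ^ c = 1"
    using \<open>l \<noteq> 0\<close> by simp_all
  then show ?thesis
    using pq eq unfolding unity_pairs_def b by (auto simp: power_add)
qed

text \<open>The positive entry exceeds 1, so it is a natural power of \<open>l\<close>. If
  \<open>Q\<close> is a reciprocal, multiplying by its denominator restores natural
  exponents.\<close>

lemma pos_neg_unity_pairs:
  fixes l :: real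
  assumes l: "l > 1" and P: "P = l ^ M \<or> P = 1 / l ^ M" and Q: "Q = l ^ N \<or> Q = 1 / l ^ N"
    and eq: "P - Q = 1"
  shows "\<exists>a b. (a, b) \<in> unity_exponents l \<and> (P, - Q) \<in> unity_pairs l a b"
proof -
  have "Q > 0" using Q l by auto
  then have "P > 1" using eq by linarith
  moreover have "1 / l ^ M \<le> 1" using l by simp
  ultimately have P': "P = l ^ M" using P by linarith
  from Q show ?thesis
  proof
    assume "Q = l ^ N"
    then have "(N, M) \<in> unity_exponents l" "(P, - Q) \<in> unity_pairs l N M"
      using P' eq by (auto simp: unity_exponents_def unity_pairs_def)
    then show ?thesis by blast
  next
    assume Q': "Q = 1 / l ^ N"
    have "(N, M + N) \<in> unity_exponents l"
      using eq l unfolding P' Q' by (simp add: unity_exponents_def power_add field_simps)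
    moreover have "(P, - Q) \<in> unity_pairs l N (M + N)"
      by (simp add: P' Q' unity_pairs_def)
    ultimately show ?thesis by blast
  qed
qed

text \<open>Both entries lie below 1, so both are reciprocals; multiplying by the larger denominator
  gives the relation.\<close>

lemma pos_pos_unity_pairs:
  fixes l :: real
  assumes l: "l > 1" and P: "P = l ^ M \<or> P = 1 / l ^ M" and Q: "Q = l ^ N \<or> Q = 1 / l ^ N"
    and eq: "P + Q = 1"
  shows "\<exists>a b. (a, b) \<in> unity_exponents l \<and> (P, Q) \<in> unity_pairs l a b"
proof -
  have "Q > 0" "P > 0" using P Q l by auto
  then have "P < 1" "Q < 1" using eq by linarith+
  moreover have "l ^ M \<ge> 1" "l ^ N \<ge> 1" using l by simp_all
  ultimately have P': "P = 1 / l ^ M" and Q': "Q = 1 / l ^ N" using P Q by linarith+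
  have *: "\<exists>a b. (a, b) \<in> unity_exponents l \<and> (1 / l ^ M, 1 / l ^ N) \<in> unity_pairs l a b"
    if MN: "1 / l ^ M + 1 / l ^ N = 1" "N \<le> M" for M N
  proof -
    obtain k where k: "M = N + k" using le_Suc_ex[OF MN(2)] by blast
    have "(k, M) \<in> unity_exponents l"
      using MN(1) l unfolding k by (simp add: unity_exponents_def power_add field_simps)
    moreover have "(1 / l ^ M, 1 / l ^ N) \<in> unity_pairs l k M"
      by (simp add: k unity_pairs_def)
    ultimately show ?thesis by blast
  qed
  show ?thesis
  proof (cases "N \<le> M")
    case True
    then show ?thesis using * eq by (simp add: P' Q')
  next
    case False
    then have "\<exists>a b. (a, b) \<in> unity_exponents l \<and> (Q, P) \<in> unity_pairs l a b"
      using *[of N M] eq by (simp add: P' Q' add.commute)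
    then show ?thesis using unity_pairs_swap by blast
  qed
qed

lemma triads_at_unity_eq:
  assumes l: "l > 1"
  shows "triads_at_unity l = (\<Union>(a, b)\<in>unity_exponents l. unity_pairs l a b)"
proof (intro set_eqI iffI)
  fix pq assume "pq \<in> triads_at_unity l"
  then obtain p q where pq: "pq = (p, q)" "p \<in> loglattice l" "q \<in> loglattice l" "p + q = 1"
    by (auto simp: triads_at_unity_def)
  obtain M where M: "p = l ^ M \<or> p = 1 / l ^ M \<or> - p = l ^ M \<or> - p = 1 / l ^ M"
    using pq(2) unfolding loglattice_iff by fastforce
  obtain N where N: "q = l ^ N \<or> q = 1 / l ^ N \<or> - q = l ^ N \<or> - q = 1 / l ^ N"
    using pq(3) unfolding loglattice_iff by fastforce
  have pos: "l ^ n > 0" "1 / l ^ n > 0" for n using l by auto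
  have "\<exists>a b. (a, b) \<in> unity_exponents l \<and> (p, q) \<in> unity_pairs l a b"
  proof (cases "p > 0")
    case p: True
    then have M': "p = l ^ M \<or> p = 1 / l ^ M" using M pos[of M] by linarith
    show ?thesis
    proof (cases "q > 0")
      case True
      then have "q = l ^ N \<or> q = 1 / l ^ N" using N pos[of N] by linarith
      then show ?thesis using pos_pos_unity_pairs[OF l M'] pq(4) by blast
    next
      case False
      then have "- q = l ^ N \<or> - q = 1 / l ^ N" using N pos[of N] by linarith
      from pos_neg_unity_pairs[OF l M' this] show ?thesis using pq(4) by simp
    qed
  next
    case False
    then have M': "- p = l ^ M \<or> - p = 1 / l ^ M" using M pos[of M] by linarith
    have "q > 0" using False pq(4) by linarith
    then have "q = l ^ N \<or> q = 1 / l ^ N" using N pos[of N] by linarith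
    from pos_neg_unity_pairs[OF l this M'] show ?thesis using pq(4) unity_pairs_swap by auto
  qed
  then show "pq \<in> (\<Union>(a, b)\<in>unity_exponents l. unity_pairs l a b)" using pq(1) by blast
next
  fix pq assume "pq \<in> (\<Union>(a, b)\<in>unity_exponents l. unity_pairs l a b)"
  then obtain a b where "(a, b) \<in> unity_exponents l" "pq \<in> unity_pairs l a b" by auto
  moreover obtain p q where "pq = (p, q)" by fastforce
  ultimately show "pq \<in> triads_at_unity l"
    using unity_pairs_in_loglattice unity_pairs_sum[OF l] unfolding triads_at_unity_def by blast
qed

subsection \<open>Nondegeneracy\<close>

lemma adjacent_sym: "adjacent l x y \<Longrightarrow> adjacent l y x"
  unfolding adjacent_def by blast

lemma reachable_sym: "(adjacent l)\<^sup>*\<^sup>* x y \<Longrightarrow> (adjacent l)\<^sup>*\<^sup>* y x"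
  by (metis adjacent_sym symp_def symp_rtranclp)

text \<open>The shifts \<open>n\<close> for which every node \<open>x\<close> reaches
  \<open>x * l powi n\<close> form a subgroup of the integers. It contains \<open>a\<close> and
  \<open>b\<close>, hence 1 by Bezout. Signs are changed through the triad
  \<open>- x = x * l^a - x * l^b\<close>.\<close>

lemma nondegenerate_if_coprime:
  assumes l: "l > 1" and ab: "(a, b) \<in> unity_exponents l" "coprime a b"
  shows "nondegenerate l"
proof -
  define G where "G = {n::int. \<forall>x \<in> loglattice l. (adjacent l)\<^sup>*\<^sup>* x (x * l powi n)}"
  have l0: "l \<noteq> 0" using l by simp
  have lat: "x * l ^ n \<in> loglattice l" "- x \<in> loglattice l" "x * l powi m \<in> loglattice l"
    if "x \<in> loglattice l" for x n m
    using that l0 by (auto intro!: mult_in_loglattice power_in_loglattice uminus_in_loglattice)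
      (auto simp: loglattice_def)
  have eq: "l ^ b = l ^ a + 1" using ab by (simp add: unity_exponents_def)
  have adj: "adjacent l x (x * l ^ b)" "adjacent l x (x * l ^ a)" if x: "x \<in> loglattice l" for x
  proof -
    have "x * l ^ b = x + x * l ^ a" by (simp add: eq algebra_simps)
    then have "triad l (x * l ^ b) x (x * l ^ a)"
      using x lat(1) unfolding triad_def by blast
    then show "adjacent l x (x * l ^ b)" "adjacent l x (x * l ^ a)"
      unfolding adjacent_def by blast+
  qed
  have neg: "(adjacent l)\<^sup>*\<^sup>* x (- x)" if x: "x \<in> loglattice l" for x
  proof -
    have "- x = x * l ^ a + - (x * l ^ b)" by (simp add: eq algebra_simps)
    then have "triad l (- x) (x * l ^ a) (- (x * l ^ b))"
      using x lat(1,2) unfolding triad_def by blast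
    then have "adjacent l (x * l ^ a) (- x)" unfolding adjacent_def by blast
    then show ?thesis using adj(2)[OF x] by (meson r_into_rtranclp rtranclp.rtrancl_into_rtrancl)
  qed
  have G_add: "m + n \<in> G" if "m \<in> G" "n \<in> G" for m n
    unfolding G_def
  proof safe
    fix x assume x: "x \<in> loglattice l"
    have "(adjacent l)\<^sup>*\<^sup>* x (x * l powi m)" using that x by (simp add: G_def)
    moreover have "(adjacent l)\<^sup>*\<^sup>* (x * l powi m) (x * l powi m * l powi n)"
      using that lat x by (simp add: G_def)
    ultimately show "(adjacent l)\<^sup>*\<^sup>* x (x * l powi (m + n))"
      using l0 by (simp add: power_int_add mult.assoc)
  qed
  have G_minus: "- m \<in> G" if "m \<in> G" for m
    unfolding G_def
  proof safe
    fix x assume x: "x \<in> loglattice l"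
    have "(adjacent l)\<^sup>*\<^sup>* (x * l powi (- m)) (x * l powi (- m) * l powi m)"
      using that lat x by (simp add: G_def)
    moreover have "x * l powi (- m) * l powi m = x"
      using l0 by (simp add: power_int_minus)
    ultimately show "(adjacent l)\<^sup>*\<^sup>* x (x * l powi (- m))" using reachable_sym by simp
  qed
  have "0 \<in> G" by (simp add: G_def)
  then have G_nat: "int n * m \<in> G" if "m \<in> G" for n m
    using that by (induction n) (simp_all add: G_add distrib_right)
  have G_mult: "k * m \<in> G" if "m \<in> G" for k m
    using G_nat[OF that, of "nat k"] G_minus[OF G_nat[OF that, of "nat (- k)"]] by (cases "k \<ge> 0") auto
  have "int a \<in> G" "int b \<in> G" using adj by (auto simp: G_def)
  moreover obtain u v where "u * int a + v * int b = 1"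
    using ab(2) bezout_int[of "int a" "int b"] by auto
  ultimately have "1 \<in> G" using G_mult G_add by metis
  then have G: "n \<in> G" for n using G_mult[of 1 n] by simp
  have one: "(adjacent l)\<^sup>*\<^sup>* 1 x" if x: "x \<in> loglattice l" for x
  proof -
    have *: "(adjacent l)\<^sup>*\<^sup>* 1 (l powi n)" for n using G[of n] by (auto simp: G_def dest: bspec[of _ _ 1])
    obtain n where "x = l powi n \<or> x = - (l powi n)" using x by (auto simp: loglattice_def)
    moreover have "(adjacent l)\<^sup>*\<^sup>* (l powi n) (- (l powi n))"
      by (rule neg) (auto simp: loglattice_def)
    ultimately show ?thesis using * rtranclp_trans[of "adjacent l"] by metis
  qed
  show ?thesis
    unfolding nondegenerate_def using one reachable_sym rtranclp_trans[of "adjacent l"] by metis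
qed

text \<open>Adjacency never leaves the sublattice generated by \<open>l^g\<close>, which contains 1
  but not \<open>l\<close>. The value \<open>g = 0\<close> is allowed and gives the sublattice of 1
  and -1.\<close>

lemma degenerate_if_common_divisor:
  assumes l: "l > 1" and g: "g \<noteq> 1"
    and dvd: "\<And>a b. (a, b) \<in> unity_exponents l \<Longrightarrow> g dvd a \<and> g dvd b"
  shows "\<not> nondegenerate l"
proof
  assume nondeg: "nondegenerate l"
  have l0: "l \<noteq> 0" and lg0: "l ^ g \<noteq> 0" using l by simp_all
  have unity: "p \<in> loglattice (l ^ g) \<and> q \<in> loglattice (l ^ g)" if pq: "(p, q) \<in> triads_at_unity l" for p q
  proof -
    obtain a b where ab: "(a, b) \<in> unity_exponents l" "(p, q) \<in> unity_pairs l a b"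
      using pq unfolding triads_at_unity_eq[OF l] by auto
    obtain a' b' where "a = g * a'" "b = g * b'" using dvd[OF ab(1)] by (auto elim!: dvdE)
    \<comment> \<open>All exponents are multiples of \<open>g\<close>, so the same pairs arise from
      the base \<open>l ^ g\<close>.\<close>
    then have "unity_pairs l a b = unity_pairs (l ^ g) a' b'"
      by (simp add: unity_pairs_def power_mult flip: diff_mult_distrib2)
    then show ?thesis using ab(2) unity_pairs_in_loglattice by blast
  qed
  have step: "y \<in> loglattice (l ^ g)" if x: "x \<in> loglattice (l ^ g)" and xy: "adjacent l x y" for x y
  proof -
    obtain k p q where t: "triad l k p q" "x \<in> {k, p, q}" "y \<in> {k, p, q}"
      using xy unfolding adjacent_def by blast
    have k0: "k \<noteq> 0" using t(1) nonzero_of_loglattice[OF l0] by (auto simp: triad_def)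
    have "(p / k, q / k) \<in> triads_at_unity l"
      using t(1) k0 divide_in_loglattice[OF l0]
      by (auto simp: triad_def triads_at_unity_def simp flip: add_divide_distrib)
    then have u: "p / k \<in> loglattice (l ^ g)" "q / k \<in> loglattice (l ^ g)" using unity by auto
    have "x / k \<in> loglattice (l ^ g)" "y / k \<in> loglattice (l ^ g)" using t(2,3) u k0 by auto
    \<comment> \<open>The first quotient is \<open>k\<close>, which is thereby in the sublattice
      together with \<open>x\<close>; multiplying by \<open>y / k\<close> then reaches
      \<open>y\<close>.\<close>
    then have "x / (x / k) * (y / k) \<in> loglattice (l ^ g)"
      using divide_in_loglattice[OF lg0 x] mult_in_loglattice[OF lg0] by blast
    then show ?thesis using k0 nonzero_of_loglattice[OF lg0 x] by simp
  qed
  have "y \<in> loglattice (l ^ g)" if "(adjacent l)\<^sup>*\<^sup>* 1 y" for y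
    using that by (induction rule: rtranclp_induct) (use step in auto)
  moreover have "(adjacent l)\<^sup>*\<^sup>* 1 l"
    using nondeg power_in_loglattice[of l 1] by (simp add: nondegenerate_def)
  ultimately have "l \<in> loglattice (l ^ g)" by blast
  then obtain n where "l = (l ^ g) ^ n \<or> l = 1 / (l ^ g) ^ n \<or> l = - ((l ^ g) ^ n) \<or> l = - (1 / (l ^ g) ^ n)"
    unfolding loglattice_iff by blast
  moreover have "(l ^ g) ^ n \<ge> 1" using l by simp
  then have "1 / (l ^ g) ^ n \<le> 1" "1 / (l ^ g) ^ n > 0" by simp_all
  ultimately have "l = (l ^ g) ^ n" using l \<open>(l ^ g) ^ n \<ge> 1\<close> by linarith
  then have "l ^ 1 = l ^ (g * n)" by (simp add: power_mult)
  then have "1 = g * n" using l power_inject_exp by blast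
  then show False using g by simp
qed

lemma nondegenerate_iff:
  assumes l: "l > 1"
  shows "nondegenerate l \<longleftrightarrow> (\<exists>a b. (a, b) \<in> unity_exponents l \<and> coprime a b)"
proof
  assume nondeg: "nondegenerate l"
  show "\<exists>a b. (a, b) \<in> unity_exponents l \<and> coprime a b"
  proof (rule ccontr)
    assume none: "\<not> ?thesis"
    show False
    proof (cases "unity_exponents l = {}")
      case True
      \<comment> \<open>Without any relation the divisibility condition is vacuous, so 0 serves as
        the common divisor.\<close>
      then show ?thesis using degenerate_if_common_divisor[OF l, of 0] nondeg by simp
    next
      case False
      then obtain a b where ab: "(a, b) \<in> unity_exponents l" by auto
      have "gcd a b \<noteq> 1" using none ab by (auto simp: coprime_iff_gcd_eq_1)
      moreover have "gcd a b dvd c \<and> gcd a b dvd d" if "(c, d) \<in> unity_exponents l" for c d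
        using unity_exponents_common_gcd[OF l ab that] by simp
      ultimately show ?thesis using degenerate_if_common_divisor[OF l] nondeg by blast
    qed
  qed
qed (use nondegenerate_if_coprime[OF l] in blast)

subsection \<open>The plastic number\<close>

text \<open>This is Cardano's formula: the cube of \<open>u + v\<close> is
  \<open>u^3 + v^3 + 3uv(u + v)\<close>, and the product \<open>u * v * c\<close> is
  rational.\<close>

lemma plastic_cubed: "plastic ^ 3 = plastic + 1"
proof -
  define u where "u = root 3 (9 + sqrt 69)"
  define v where "v = root 3 (9 - sqrt 69)"
  define c where "c = root 3 (18::real)"
  have u3: "u ^ 3 = 9 + sqrt 69" and v3: "v ^ 3 = 9 - sqrt 69" and c3: "c ^ 3 = 18"
    by (simp_all add: u_def v_def c_def odd_real_root_pow)
  have "c > 0" by (simp add: c_def)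
  \<comment> \<open>The value is \<open>(81 - 69) * 18 = 216\<close>, and real cube roots are
    unique.\<close>
  have "(u * v * c) ^ 3 = ((9 + sqrt 69) * (9 - sqrt 69)) * 18"
    by (simp add: power_mult_distrib u3 v3 c3)
  also have "\<dots> = 6 ^ 3" by (simp add: algebra_simps)
  finally have "u * v * c = 6" by (metis odd_numeral odd_real_root_power_cancel)
  define p where "p = (u + v) / c"
  have "c * p = u + v" using \<open>c > 0\<close> by (simp add: p_def)
  then have "(c * p) ^ 3 = u ^ 3 + v ^ 3 + 3 * (u * v) * (c * p)"
    by (simp add: power3_eq_cube algebra_simps)
  also have "3 * (u * v) * (c * p) = 3 * (u * v * c) * p" by (simp add: ac_simps)
  finally have "18 * p ^ 3 = 18 + 18 * p"
    using u3 v3 c3 \<open>u * v * c = 6\<close> by (simp add: power_mult_distrib)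
  moreover have "plastic = p" by (simp add: plastic_def p_def u_def v_def c_def)
  ultimately show ?thesis by simp
qed

lemma eq_plastic_iff:
  assumes "l > 1"
  shows "l = plastic \<longleftrightarrow> l ^ 3 = l + 1"
proof
  assume l: "l ^ 3 = l + 1"
  \<comment> \<open>The bound 1.2 serves two purposes: its cube 1.728 is below 2, hence below
    \<open>l + 1\<close>, and its square 1.44 exceeds 4/3, which makes the quadratic cofactor
    \<open>(plastic + l/2)^2 + 3/4 * l^2 - 1\<close> positive.\<close>
  have "l > 1.2"
  proof (rule ccontr)
    assume "\<not> l > 1.2"
    then have "l ^ 3 \<le> 1.2 ^ 3" using assms by (intro power_mono) auto
    then show False using assms l by (simp add: power3_eq_cube)
  qed
  then have "l * l > 1.2 * 1.2" by (intro mult_strict_mono) auto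
  then have "l\<^sup>2 + l * plastic + plastic\<^sup>2 - 1 > 0"
    using zero_le_power2[of "plastic + l / 2"] by (simp add: power2_eq_square algebra_simps)
  moreover have "(l - plastic) * (l\<^sup>2 + l * plastic + plastic\<^sup>2 - 1) = 0"
    using l plastic_cubed by (simp add: algebra_simps power2_eq_square power3_eq_cube)
  ultimately show "l = plastic" by simp
qed (simp add: plastic_cubed)

text \<open>From \<open>l^a * (l - 1) \<le> l^b - l^a = 1\<close> follow \<open>l^a \<le> 20\<close>
  and \<open>l^b \<le> 21\<close>, whereas already \<open>1.05^63 > 21\<close>.\<close>

lemma unity_exponents_bound:
  assumes l: "l \<ge> 1.05" and ab: "(a, b) \<in> unity_exponents l"
  shows "b \<le> 62"
proof (rule ccontr)
  assume "\<not> b \<le> 62"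
  have "a < b" using unity_exponents_less[OF _ ab] l by simp
  then have "l ^ Suc a \<le> l ^ b" using l by (intro power_increasing) auto
  moreover have eq: "l ^ b - l ^ a = 1" using ab by (simp add: unity_exponents_def)
  moreover have "1.05 * l ^ a \<le> l * l ^ a" using l by (intro mult_right_mono) auto
  ultimately have "l ^ a \<le> 20" by simp
  have "(1.05::real) ^ 63 \<le> l ^ 63" using l by (intro power_mono) auto
  also have "\<dots> \<le> l ^ b" using \<open>\<not> b \<le> 62\<close> l by (intro power_increasing) auto
  also have "\<dots> \<le> 21" using eq \<open>l ^ a \<le> 20\<close> by simp
  finally show False by (simp add: power_divide)
qed

lemma unity_exponents_plastic_iff:
  assumes "l > 1"
  shows "l = plastic \<longleftrightarrow> (1, 3) \<in> unity_exponents l"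
    and "l = plastic \<longleftrightarrow> (4, 5) \<in> unity_exponents l"
proof -
  have "(1, 3) \<in> unity_exponents l \<longleftrightarrow> l ^ 3 = l + 1" by (auto simp: unity_exponents_def)
  then show "l = plastic \<longleftrightarrow> (1, 3) \<in> unity_exponents l" using eq_plastic_iff[OF assms] by simp
  \<comment> \<open>The quadratic factor is positive for \<open>l > 1\<close>, so the quintic and
    the cubic vanish together.\<close>
  have "l ^ 5 - l ^ 4 - 1 = (l\<^sup>2 - l + 1) * (l ^ 3 - l - 1)"
    by (simp add: algebra_simps eval_nat_numeral)
  moreover have "l\<^sup>2 - l + 1 > 0" using assms mult_strict_mono[of 1 l 1 l]
    by (simp add: power2_eq_square add_pos_pos)
  ultimately have "l ^ 5 - l ^ 4 - 1 = 0 \<longleftrightarrow> l ^ 3 - l - 1 = 0" by simp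
  then have "(4, 5) \<in> unity_exponents l \<longleftrightarrow> l ^ 3 = l + 1" by (auto simp: unity_exponents_def)
  then show "l = plastic \<longleftrightarrow> (4, 5) \<in> unity_exponents l" using eq_plastic_iff[OF assms] by simp
qed

lemma unity_exponents_plastic:
  assumes "l > 1" "l = plastic"
  shows "unity_exponents l = {(1, 3), (4, 5)}"
proof (intro set_eqI iffI)
  fix p assume p: "p \<in> unity_exponents l"
  obtain c d where cd: "p = (c, d)" by fastforce
  have "(1, 3) \<in> unity_exponents l" using unity_exponents_plastic_iff assms by blast
  from unity_exponents_unique[OF assms(1) this, of c d] p cd show "p \<in> {(1, 3), (4, 5)}" by auto
qed (use unity_exponents_plastic_iff[OF assms(1)] assms in auto)

theorem theorem1:
  fixes l :: real
  assumes "l \<ge> 1.05"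
  shows "(nondegenerate l \<longleftrightarrow>
           (l = 2 \<or> l = plastic \<or>
            (\<exists>a b :: nat. a < b \<and> b \<le> 62 \<and> coprime a b \<and> (a, b) \<noteq> (1, 3) \<and> (a, b) \<noteq> (4, 5)
                 \<and> 1 = l ^ b - l ^ a))) \<and>
     (l = 2 \<longrightarrow> triads_at_unity l = {(2, -1), (-1, 2), (1/2, 1/2)}) \<and>
     (l = plastic \<longrightarrow> triads_at_unity l =
           {(l^3, -l), (-l, l^3), (l^2, -(1/l)), (-(1/l), l^2),
            (1/l^3, 1/l^2), (1/l^2, 1/l^3), (l^5, -(l^4)), (-(l^4), l^5),
            (l, -(1/l^4)), (-(1/l^4), l), (1/l^5, 1/l), (1/l, 1/l^5)}) \<and>
     (\<forall>a b :: nat. a < b \<and> b \<le> 62 \<and> coprime a b \<and> (a, b) \<noteq> (1, 3) \<and> (a, b) \<noteq> (4, 5)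
             \<and> 1 = l ^ b - l ^ a \<longrightarrow>
           triads_at_unity l =
             {(l^b, -(l^a)), (-(l^a), l^b), (l^(b-a), -(1/l^a)), (-(1/l^a), l^(b-a)),
              (1/l^b, 1/l^(b-a)), (1/l^(b-a), 1/l^b)})"
proof (intro conjI impI allI)
  have l: "l > 1" using assms by simp
  show "nondegenerate l \<longleftrightarrow>
           (l = 2 \<or> l = plastic \<or>
            (\<exists>a b :: nat. a < b \<and> b \<le> 62 \<and> coprime a b \<and> (a, b) \<noteq> (1, 3) \<and> (a, b) \<noteq> (4, 5)
                 \<and> 1 = l ^ b - l ^ a))" (is "_ \<longleftrightarrow> ?cases")
  proof
    assume "nondegenerate l"
    then obtain a b where ab: "(a, b) \<in> unity_exponents l" "coprime a b"
      using nondegenerate_iff[OF l] by blast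
    show ?cases
    proof (cases "l = plastic")
      case False
      then have "(a, b) \<noteq> (1, 3)" "(a, b) \<noteq> (4, 5)"
        using ab(1) unity_exponents_plastic_iff[OF l] by metis+
      moreover have "1 = l ^ b - l ^ a" using ab(1) by (simp add: unity_exponents_def)
      moreover have "a < b" "b \<le> 62"
        using unity_exponents_less[OF l ab(1)] unity_exponents_bound[OF assms ab(1)] .
      ultimately show ?thesis using ab(2) by blast
    qed blast
  next
    assume ?cases
    then have "\<exists>a b. (a, b) \<in> unity_exponents l \<and> coprime a b"
    proof (elim disjE)
      assume "l = 2"
      then have "(0, 1) \<in> unity_exponents l" by (simp add: unity_exponents_def)
      then show ?thesis using coprime_1_right by blast
    next
      assume "l = plastic"
      then have "(1, 3) \<in> unity_exponents l" using unity_exponents_plastic_iff[OF l] by blast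
      then show ?thesis using coprime_1_left by blast
    qed (auto simp: unity_exponents_def)
    then show "nondegenerate l" using nondegenerate_iff[OF l] by blast
  qed
  \<comment> \<open>This covers the third case and also \<open>l = 2\<close>, which is the relation
    with exponents (0, 1); there the six pairs collapse to three.\<close>
  have single: "triads_at_unity l = unity_pairs l a b"
    if "1 = l ^ b - l ^ a" "coprime a b" "(a, b) \<noteq> (1, 3)" "(a, b) \<noteq> (4, 5)" for a b
    using unity_exponents_coprime_unique[OF l _ that(2-4)] that(1) triads_at_unity_eq[OF l]
    by (simp add: unity_exponents_def)
  show "triads_at_unity l = {(2, -1), (-1, 2), (1/2, 1/2)}" if "l = 2"
    using single[of 1 0] that by (auto simp: unity_pairs_def)
  show "triads_at_unity l =
           {(l^3, -l), (-l, l^3), (l^2, -(1/l)), (-(1/l), l^2),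
            (1/l^3, 1/l^2), (1/l^2, 1/l^3), (l^5, -(l^4)), (-(l^4), l^5),
            (l, -(1/l^4)), (-(1/l^4), l), (1/l^5, 1/l), (1/l, 1/l^5)}" if "l = plastic"
  proof -
    have "triads_at_unity l = unity_pairs l 4 5 \<union> unity_pairs l 1 3"
      unfolding triads_at_unity_eq[OF l] unity_exponents_plastic[OF l that] by auto
    then show ?thesis unfolding unity_pairs_def by simp
  qed
  show "triads_at_unity l =
             {(l^b, -(l^a)), (-(l^a), l^b), (l^(b-a), -(1/l^a)), (-(1/l^a), l^(b-a)),
              (1/l^b, 1/l^(b-a)), (1/l^(b-a), 1/l^b)}"
    if "a < b \<and> b \<le> 62 \<and> coprime a b \<and> (a, b) \<noteq> (1, 3) \<and> (a, b) \<noteq> (4, 5) \<and> 1 = l ^ b - l ^ a"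
    for a b
    using single[of b a] that unfolding unity_pairs_def by blast
qed

end
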